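(* Let $k\ge1$. The map that assigns to each Dyck nest $H$ of length $2k$ its clone $\sigma(H)=(\sigma_{k-1}(H),\ldots,\sigma_1(H))$ is a bijection from the set of Dyck nests of length $2k$ onto the set of their clones; that is, distinct Dyck nests of length $2k$ have distinct clones.
   Context: A Dyck word of length $2k$ is a binary string with $k$ ones in which every prefix has at least as many 0s as 1s. Reading it left to right, 0 = up-step and 1 = down-step gives a lattice path from height 0. Its Dyck nest is the integer string of length $2k$ obtained by labelling the steps with $1,2,\ldots,k$: process the horizontal unit layers $[y,y+1]$, $y=0,1,2,\ldots$, in increasing order, and in each layer assign consecutive integers (continuing the count from earlier layers) to the up-steps from right to left and likewise to the down-steps from right to left. Each value in $[1,k]$ occurs exactly twice. For a Dyck nest $H$ and $j\in[1,k-1]$, let $p_j<r_j$ be the two positions of $H$ holding the value $j$, and let $\sigma_j(H)=\lfloor (r_j-p_j)/2\rfloor$; the clone of $H$ is the vector $\sigma(H)=(\sigma_{k-1}(H),\ldots,\sigma_1(H))$. (In the paper the Dyck nests of length $2k$ are enumerated as the "$k$-blown" nests $F^k(n)$, $0\le n<\frac{(2k)!}{k!(k+1)!}$, each Dyck nest of length $2k$ occurring exactly once.) *)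

theory Defs
  imports Main
begin

text \<open>Binary strings are lists over 0 and 1, read as lattice paths from height 0
  (0 = up-step, 1 = down-step); positions are counted from 0.\<close>

definition dyck_word :: "nat \<Rightarrow> nat list \<Rightarrow> bool" where
  "dyck_word k w \<longleftrightarrow>
     length w = 2 * k \<and> set w \<subseteq> {0, 1} \<and> count_list w 1 = k \<and>
     (\<forall>n\<le>length w. count_list (take n w) 1 \<le> count_list (take n w) 0)"

definition height :: "nat list \<Rightarrow> nat \<Rightarrow> int" where
  "height w n = int (count_list (take n w) 0) - int (count_list (take n w) 1)"

text \<open>The step at position \<open>i\<close> joins the heights \<open>height w i\<close> and \<open>height w (Suc i)\<close>, which
  differ by one; it lies in the layer \<open>[y, y + 1]\<close> with \<open>y\<close> the smaller of the two.\<close>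

definition layer :: "nat list \<Rightarrow> nat \<Rightarrow> int" where
  "layer w i = min (height w i) (height w (Suc i))"

text \<open>Numbering the up-steps (and likewise the down-steps) layer by layer from the bottom, and
  from right to left inside each layer, gives a step as label its rank among the steps of its
  own kind: it counts those in lower layers and those in its own layer that are not to its left.
  As a Dyck word has equally many up-steps and down-steps in every layer, both kinds start a new
  layer at the same number.\<close>

definition step_label :: "nat list \<Rightarrow> nat \<Rightarrow> nat" where
  "step_label w i =
     card {j \<in> {..<length w}. w ! j = w ! i \<and>
             (layer w j < layer w i \<or> (layer w j = layer w i \<and> i \<le> j))}"

definition dyck_nest :: "nat list \<Rightarrow> nat list" where
  "dyck_nest w = map (step_label w) [0..<length w]"

definition dyck_nests :: "nat \<Rightarrow> nat list set" where
  "dyck_nests k = dyck_nest ` {w. dyck_word k w}"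

definition positions :: "nat list \<Rightarrow> nat \<Rightarrow> nat set" where
  "positions H j = {i \<in> {..<length H}. H ! i = j}"

text \<open>In a Dyck nest of length \<open>2 * k\<close> every \<open>j \<in> {1..k}\<close> occupies exactly two positions, so
  \<open>Min\<close> and \<open>Max\<close> are the left and the right one. Division on \<open>nat\<close> rounds down.\<close>

definition clone_entry :: "nat list \<Rightarrow> nat \<Rightarrow> nat" where
  "clone_entry H j = (Max (positions H j) - Min (positions H j)) div 2"

definition clone :: "nat \<Rightarrow> nat list \<Rightarrow> nat list" where
  "clone k H = map (clone_entry H) (rev [1..<k])"

end

theory Submission
  imports Defs
begin

text \<open>The up-step and the down-step carrying the same label are matched parentheses, so the
  clone lists the half-lengths of the arches of the path in the order of their labels. The
  positions of the labels are recovered from the clone in increasing order. Once those of the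
  labels below \<open>j\<close> are known, every unlabelled step has a known number of labelled arches above
  it, and the down-step labelled \<open>j\<close> is the rightmost unlabelled step for which this number is
  minimal. The corresponding up-step is then found from the length of the arch.\<close>

lemma inj_on_image_eq_atLeastAtMost_card:
  assumes "inj_on f A" "finite A" "f ` A \<subseteq> {1..card A}"
  shows "f ` A = {1..card A}"
  by (rule card_subset_eq) (use assms in \<open>simp_all add: card_image\<close>)

section \<open>Heights, layers and step counts of a Dyck path\<close>

locale dyck_path =
  fixes k :: nat and w :: "nat list"
  assumes dyck: "dyck_word k w"
begin

lemma length_w: "length w = 2 * k"
  using dyck by (simp add: dyck_word_def)

lemma step_cases:
  assumes "i < 2 * k"
  shows "w ! i = 0 \<or> w ! i = 1"
proof -
  have "w ! i \<in> set w"
    using assms by (simp add: length_w)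
  moreover have "set w \<subseteq> {0, 1}"
    using dyck by (simp only: dyck_word_def)
  ultimately show ?thesis
    by blast
qed

lemma height_0 [simp]: "height w 0 = 0"
  by (simp add: height_def)

lemma height_nonneg:
  assumes "i \<le> 2 * k"
  shows "0 \<le> height w i"
proof -
  have "count_list (take i w) 1 \<le> count_list (take i w) 0"
    using dyck assms unfolding dyck_word_def by (elim conjE) simp
  then show ?thesis
    by (simp add: height_def)
qed

lemma height_Suc:
  assumes "i < 2 * k"
  shows "height w (Suc i) = (if w ! i = 0 then height w i + 1 else height w i - 1)"
  using assms step_cases[OF assms] by (auto simp: height_def take_Suc_conv_app_nth length_w)

lemma layer_up: "i < 2 * k \<Longrightarrow> w ! i = 0 \<Longrightarrow> layer w i = height w i"
  by (simp add: layer_def height_Suc)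

lemma layer_down: "i < 2 * k \<Longrightarrow> w ! i = 1 \<Longrightarrow> layer w i = height w (Suc i)"
  by (simp add: layer_def height_Suc)

lemma layer_nonneg: "i < 2 * k \<Longrightarrow> 0 \<le> layer w i"
  by (simp add: layer_def height_nonneg)

text \<open>Each step changes the height by one. This is what puts the two steps of an arch at odd
  distance.\<close>

lemma parity_height: "i \<le> 2 * k \<Longrightarrow> even (height w i) \<longleftrightarrow> even i"
  by (induction i) (auto simp: height_Suc)

lemma card_steps_eq_count: "card {i. i < n \<and> w ! i = a} = count_list (take n w) a"
  if "n \<le> 2 * k"
  using that
proof (induction n)
  case (Suc n)
  have "{i. i < Suc n \<and> w ! i = a} = {i. i < n \<and> w ! i = a} \<union> (if w ! n = a then {n} else {})"
    by (auto simp: less_Suc_eq)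
  with Suc show ?case
    by (auto simp: take_Suc_conv_app_nth length_w)
qed simp

lemma card_downs: "card {i. i < 2 * k \<and> w ! i = 1} = k"
proof -
  have "count_list w 1 = k"
    using dyck by (simp only: dyck_word_def)
  then show ?thesis
    by (simp only: card_steps_eq_count[OF order_refl] take_all length_w)
qed

lemma card_ups: "card {i. i < 2 * k \<and> w ! i = 0} = k"
proof -
  let ?U = "{i. i < 2 * k \<and> w ! i = 0}" and ?D = "{i. i < 2 * k \<and> w ! i = 1}"
  have "?U \<union> ?D = {..<2 * k}"
    using step_cases by blast
  moreover have "card (?U \<union> ?D) = card ?U + card ?D"
    by (rule card_Un_disjoint) auto
  ultimately have "card ?U + k = 2 * k"
    by (simp only: card_downs card_lessThan)
  then show ?thesis
    by linarith
qed

lemma height_end: "height w (2 * k) = 0"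
  by (simp only: height_def card_steps_eq_count[OF order_refl, symmetric] card_ups card_downs)

section \<open>Balance of up-steps and down-steps in the layers\<close>

definition steps_below :: "nat \<Rightarrow> int \<Rightarrow> nat \<Rightarrow> nat set" where
  "steps_below a y n = {i. i < n \<and> w ! i = a \<and> layer w i < y}"

definition steps_in :: "nat \<Rightarrow> int \<Rightarrow> nat \<Rightarrow> nat set" where
  "steps_in a y n = {i. i < n \<and> w ! i = a \<and> layer w i = y}"

lemma finite_steps [simp]: "finite (steps_below a y n)" "finite (steps_in a y n)"
  by (simp_all add: steps_below_def steps_in_def)

lemma card_steps_in_Suc:
  "card (steps_in a y (Suc n)) = card (steps_in a y n) + (if w ! n = a \<and> layer w n = y then 1 else 0)"
proof -
  have "steps_in a y (Suc n) = steps_in a y n \<union> (if w ! n = a \<and> layer w n = y then {n} else {})"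
    by (auto simp: steps_in_def less_Suc_eq)
  then show ?thesis
    by (auto simp: steps_in_def)
qed

lemma card_steps_below_Suc:
  "card (steps_below a y (Suc n)) = card (steps_below a y n) + (if w ! n = a \<and> layer w n < y then 1 else 0)"
proof -
  have "steps_below a y (Suc n) = steps_below a y n \<union> (if w ! n = a \<and> layer w n < y then {n} else {})"
    by (auto simp: steps_below_def less_Suc_eq)
  then show ?thesis
    by (auto simp: steps_below_def)
qed

text \<open>The steps in a fixed layer alternate between up and down, beginning with an up-step
  because the path starts at height 0. The last one was an up-step exactly while the path is above
  \<open>y\<close>.\<close>

lemma steps_in_diff:
  assumes "0 \<le> y" "n \<le> 2 * k"
  shows "card (steps_in 0 y n) = card (steps_in 1 y n) + (if height w n > y then 1 else 0)"
  using assms(2)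
proof (induction n)
  case 0
  then show ?case using assms(1) by (simp add: steps_in_def)
next
  case (Suc n)
  then have n: "n < 2 * k" by simp
  from step_cases[OF n] show ?case
  proof
    assume "w ! n = 0"
    with Suc n layer_up[OF n] show ?thesis
      by (simp add: card_steps_in_Suc height_Suc)
  next
    assume "w ! n = 1"
    with Suc n layer_down[OF n] show ?thesis
      by (simp add: card_steps_in_Suc height_Suc split: if_splits)
  qed
qed

text \<open>This is the balance of a single layer summed over the layers 0, ...,
  \<open>y - 1\<close>, of which \<open>min (height w n) y\<close> lie under the current
  height.\<close>

lemma steps_below_diff:
  assumes "0 \<le> y" "n \<le> 2 * k"
  shows "int (card (steps_below 0 y n)) = int (card (steps_below 1 y n)) + min (height w n) y"
  using assms(2)
proof (induction n)
  case 0
  then show ?case using assms(1) by (simp add: steps_below_def)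
next
  case (Suc n)
  then have n: "n < 2 * k" by simp
  from step_cases[OF n] show ?case
  proof
    assume "w ! n = 0"
    with Suc n layer_up[OF n] show ?thesis
      by (simp add: card_steps_below_Suc height_Suc)
  next
    assume "w ! n = 1"
    with Suc n layer_down[OF n] show ?thesis
      by (simp add: card_steps_below_Suc height_Suc split: if_splits)
  qed
qed

text \<open>The path ends at height 0, so the surplus of up-steps vanishes. Bounds on labels of
  either kind can therefore be stated through down-steps alone.\<close>

lemma card_steps_below_end:
  assumes "0 \<le> y" "a \<le> 1"
  shows "card (steps_below a y (2 * k)) = card (steps_below 1 y (2 * k))"
proof (cases "a = 0")
  case True
  then show ?thesis
    using steps_below_diff[OF assms(1), of "2 * k"] assms(1) height_end by simp
next
  case False
  then have "a = 1"
    using assms(2) by linarith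
  then show ?thesis
    by simp
qed

lemma card_steps_below_end_step:
  assumes "i < 2 * k" "0 \<le> y"
  shows "card (steps_below (w ! i) y (2 * k)) = card (steps_below 1 y (2 * k))"
  by (rule card_steps_below_end[OF assms(2)]) (use step_cases[OF assms(1)] in linarith)

section \<open>Labels of the steps\<close>

lemma step_label_add:
  assumes "i < 2 * k"
  shows "step_label w i + card (steps_in (w ! i) (layer w i) i) =
    card (steps_below (w ! i) (layer w i + 1) (2 * k))"
proof -
  let ?A = "{j \<in> {..<length w}. w ! j = w ! i \<and>
    (layer w j < layer w i \<or> (layer w j = layer w i \<and> i \<le> j))}"
  \<comment> \<open>The steps of the same kind up to the layer of \<open>i\<close> are those counted
    by the label and those to the left of \<open>i\<close> in its own layer.\<close>
  have "steps_below (w ! i) (layer w i + 1) (2 * k) = ?A \<union> steps_in (w ! i) (layer w i) i"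
    using assms by (auto simp: steps_below_def steps_in_def length_w)
  moreover have "card (?A \<union> steps_in (w ! i) (layer w i) i) = card ?A + card (steps_in (w ! i) (layer w i) i)"
    by (rule card_Un_disjoint) (auto simp: steps_in_def)
  ultimately show ?thesis
    by (simp only: step_label_def)
qed

text \<open>Together with \<open>step_label_gt\<close> this confines the labels of a layer to an
  interval common to both kinds of steps. The intervals of different layers are disjoint, so labels
  compare layers even between an up-step and a down-step.\<close>

lemma step_label_le:
  assumes "i < 2 * k"
  shows "step_label w i \<le> card (steps_below 1 (layer w i + 1) (2 * k))"
  using step_label_add[OF assms] card_steps_below_end_step[OF assms, of "layer w i + 1"]
    layer_nonneg[OF assms] by linarith

lemma step_label_gt:
  assumes "i < 2 * k"
  shows "card (steps_below 1 (layer w i) (2 * k)) < step_label w i"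
proof -
  have "card (steps_below (w ! i) (layer w i) (2 * k)) < step_label w i"
    unfolding step_label_def
    by (rule psubset_card_mono) (use assms in \<open>auto simp: steps_below_def length_w\<close>)
  then show ?thesis
    by (simp only: card_steps_below_end_step[OF assms layer_nonneg[OF assms]])
qed

lemma step_label_less_if_layer_less:
  assumes "i < 2 * k" "j < 2 * k" "layer w i < layer w j"
  shows "step_label w i < step_label w j"
proof -
  have "card (steps_below 1 (layer w i + 1) (2 * k)) \<le> card (steps_below 1 (layer w j) (2 * k))"
    by (rule card_mono) (use assms in \<open>auto simp: steps_below_def\<close>)
  then show ?thesis
    using step_label_le[OF assms(1)] step_label_gt[OF assms(2)] by linarith
qed

lemma step_label_less_if_right:
  assumes "i < j" "j < 2 * k" "w ! i = w ! j" "layer w i = layer w j"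
  shows "step_label w j < step_label w i"
proof -
  let ?S = "\<lambda>i. {l \<in> {..<length w}. w ! l = w ! i \<and>
    (layer w l < layer w i \<or> (layer w l = layer w i \<and> i \<le> l))}"
  have "?S j \<subseteq> ?S i"
    using assms by force
  moreover have "i \<in> ?S i" "i \<notin> ?S j"
    using assms by (simp_all add: length_w)
  ultimately show ?thesis
    unfolding step_label_def by (intro psubset_card_mono) auto
qed

lemma step_label_inj:
  assumes "i < 2 * k" "j < 2 * k" "w ! i = w ! j" "step_label w i = step_label w j"
  shows "i = j"
proof -
  have "layer w i = layer w j"
    using assms step_label_less_if_layer_less[of i j] step_label_less_if_layer_less[of j i]
    by linarith
  then have "\<not> i < j" "\<not> j < i"
    using step_label_less_if_right[of i j] step_label_less_if_right[of j i] assms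
    by (metis less_irrefl)+
  then show ?thesis
    by simp
qed

text \<open>There are \<open>k\<close> steps of each kind, and their labels are distinct numbers
  between 1 and \<open>k\<close>, so each label occurs once per kind.\<close>

lemma step_label_image:
  assumes "a \<le> 1"
  shows "step_label w ` {i. i < 2 * k \<and> w ! i = a} = {1..k}"
proof -
  let ?S = "{i. i < 2 * k \<and> w ! i = a}"
  have card: "card ?S = k"
    using assms card_ups card_downs by (auto simp: le_Suc_eq)
  have range: "step_label w i \<in> {1..k}" if "i \<in> ?S" for i
  proof -
    have "step_label w i \<le> card ?S"
      unfolding step_label_def by (rule card_mono) (use that in \<open>auto simp: length_w\<close>)
    then show ?thesis
      using step_label_gt[of i] that card by simp
  qed
  have "inj_on (step_label w) ?S"
    by (rule inj_onI) (auto intro: step_label_inj)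
  moreover have "step_label w ` ?S \<subseteq> {1..card ?S}"
    unfolding card using range by blast
  ultimately have "step_label w ` ?S = {1..card ?S}"
    by (intro inj_on_image_eq_atLeastAtMost_card) simp_all
  then show ?thesis
    by (simp only: card)
qed

text \<open>Equal labels force equal layers, and then, by \<open>step_label_add\<close>, equally
  many steps of the own kind to the left in that layer. As up-steps and down-steps of a layer
  alternate, the down-step is the first one of the layer after the up-step.\<close>

lemma matched_steps:
  assumes "p < 2 * k" "r < 2 * k" "w ! p = 0" "w ! r = 1" "step_label w p = step_label w r"
  shows "layer w p = layer w r" "p < r" "\<And>i. p < i \<Longrightarrow> i \<le> r \<Longrightarrow> layer w p < height w i"
proof -
  show y: "layer w p = layer w r"
    using assms step_label_less_if_layer_less[of p r] step_label_less_if_layer_less[of r p] by linarith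
  define y where "y = layer w p"
  have y0: "0 \<le> y"
    using assms(1) layer_nonneg by (simp add: y_def)
  have "card (steps_in 0 y p) = card (steps_in 1 y r)"
    using step_label_add[OF assms(1)] step_label_add[OF assms(2)] assms
      card_steps_below_end[of "y + 1" 0] y0 y by (simp add: y_def)
  moreover have "card (steps_in 0 y p) = card (steps_in 1 y p)"
    using steps_in_diff[OF y0, of p] assms layer_up[of p] by (simp add: y_def)
  ultimately have eq: "card (steps_in 1 y p) = card (steps_in 1 y r)"
    "card (steps_in 0 y p) = card (steps_in 1 y r)"
    by simp_all
  have mono: "card (steps_in a y m) \<le> card (steps_in a y n)" if "m \<le> n" for a m n
    by (rule card_mono) (use that in \<open>auto simp: steps_in_def\<close>)
  show "p < r"
  proof (rule ccontr)
    assume "\<not> p < r"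
    then have "Suc r \<le> p"
      using assms by (metis Suc_leI linorder_neqE_nat zero_neq_one)
    \<comment> \<open>The down-step \<open>r\<close> would be counted before \<open>p\<close> but
      not before \<open>r\<close>, although the two counts are equal.\<close>
    from mono[OF this, of 1] show False
      using eq(1) assms y by (simp add: card_steps_in_Suc y_def)
  qed
  show "layer w p < height w i" if "p < i" "i \<le> r" for i
  proof -
    \<comment> \<open>Counting \<open>p\<close> itself, the up-steps of the layer before
      \<open>i\<close> outnumber its down-steps before \<open>r\<close>, hence also those before
      \<open>i\<close>.\<close>
    have "card (steps_in 0 y (Suc p)) \<le> card (steps_in 0 y i)"
      using that by (intro mono) simp
    then have "card (steps_in 1 y r) < card (steps_in 0 y i)"
      using eq(2) assms by (simp add: card_steps_in_Suc y_def)
    then have "card (steps_in 1 y i) < card (steps_in 0 y i)"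
      using mono[OF that(2), of 1] by simp
    then show ?thesis
      using steps_in_diff[OF y0, of i] that assms by (simp add: y_def split: if_splits)
  qed
qed

section \<open>Arches: the two positions of a label\<close>

definition lo :: "nat \<Rightarrow> nat" where "lo j = Min (positions (dyck_nest w) j)"
definition hi :: "nat \<Rightarrow> nat" where "hi j = Max (positions (dyck_nest w) j)"

lemma positions_dyck_nest: "positions (dyck_nest w) j = {i. i < 2 * k \<and> step_label w i = j}"
  by (auto simp: positions_def dyck_nest_def length_w)

lemma lo_hi:
  assumes "p < 2 * k" "r < 2 * k" "w ! p = 0" "w ! r = 1" "step_label w p = j" "step_label w r = j"
  shows "lo j = p" "hi j = r"
proof -
  have "positions (dyck_nest w) j = {p, r}"
  proof (intro equalityI subsetI)
    fix i assume "i \<in> positions (dyck_nest w) j"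
    then have i: "i < 2 * k" "step_label w i = j"
      by (auto simp: positions_dyck_nest)
    with assms have "i = p \<or> i = r"
      using step_cases[OF i(1)] step_label_inj[of i p] step_label_inj[of i r] by metis
    then show "i \<in> {p, r}"
      by simp
  qed (use assms in \<open>auto simp: positions_dyck_nest\<close>)
  then show "lo j = p" "hi j = r"
    using matched_steps(2)[of p r] assms by (auto simp: lo_def hi_def)
qed

lemma label_obtain:
  assumes "a \<le> 1" "j \<in> {1..k}"
  obtains i where "i < 2 * k" "w ! i = a" "step_label w i = j"
proof -
  have "j \<in> step_label w ` {i. i < 2 * k \<and> w ! i = a}"
    using assms(2) unfolding step_label_image[OF assms(1)] .
  then show ?thesis
    using that by blast
qed

lemma arch:
  assumes "j \<in> {1..k}"
  shows "hi j < 2 * k" "w ! lo j = 0" "w ! hi j = 1" "step_label w (lo j) = j" "step_label w (hi j) = j"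
    "lo j < hi j" "layer w (lo j) = layer w (hi j)"
    "\<And>i. lo j < i \<Longrightarrow> i \<le> hi j \<Longrightarrow> layer w (hi j) < height w i"
proof -
  obtain p where p: "p < 2 * k" "w ! p = 0" "step_label w p = j"
    using label_obtain[of 0 j] assms by auto
  obtain r where r: "r < 2 * k" "w ! r = 1" "step_label w r = j"
    using label_obtain[of 1 j] assms by auto
  have eq: "lo j = p" "hi j = r"
    using lo_hi p r by auto
  show "hi j < 2 * k" "w ! lo j = 0" "w ! hi j = 1" "step_label w (lo j) = j" "step_label w (hi j) = j"
    "lo j < hi j" "layer w (lo j) = layer w (hi j)"
    "\<And>i. lo j < i \<Longrightarrow> i \<le> hi j \<Longrightarrow> layer w (hi j) < height w i"
    using matched_steps[of p r] p r unfolding eq by auto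
qed

text \<open>Both ends of an inner step are above the base of the arch. Hence of two nested arches
  the inner one has the higher layer.\<close>

lemma layer_inside_arch:
  assumes "j \<in> {1..k}" "lo j < i" "i < hi j"
  shows "layer w (hi j) < layer w i"
  using arch(8)[OF assms(1), of i] arch(8)[OF assms(1), of "Suc i"] assms by (simp add: layer_def)

text \<open>An arch starts and ends at the same height, so \<open>lo j\<close> and
  \<open>Suc (hi j)\<close> have equal parity. The distance \<open>hi j - lo j\<close> is thus odd,
  and rounding down in the clone loses nothing.\<close>

lemma lo_eq_hi_minus_clone_entry:
  assumes "j \<in> {1..k}"
  shows "lo j = hi j - (2 * clone_entry (dyck_nest w) j + 1)"
proof -
  note a = arch[OF assms]
  have "height w (lo j) = height w (Suc (hi j))"
    using a layer_up[of "lo j"] layer_down[of "hi j"] by simp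
  then have "odd (hi j - lo j)"
    using parity_height[of "lo j"] parity_height[of "Suc (hi j)"] a by (simp, presburger)
  then have "hi j - lo j = 2 * clone_entry (dyck_nest w) j + 1"
    unfolding clone_entry_def lo_def hi_def by presburger
  then show ?thesis using a(6) by simp
qed

lemma label_in_range:
  assumes "i < 2 * k"
  shows "step_label w i \<in> {1..k}"
proof -
  have "w ! i \<le> 1"
    using step_cases[OF assms] by linarith
  from step_label_image[OF this] show ?thesis
    using assms by blast
qed

lemma step_of_label:
  assumes "i < 2 * k"
  shows "i = lo (step_label w i) \<or> i = hi (step_label w i)"
proof -
  note a = arch[OF label_in_range[OF assms]]
  show ?thesis
    using step_cases[OF assms] step_label_inj[of i "lo (step_label w i)"]
      step_label_inj[of i "hi (step_label w i)"] a assms by auto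
qed

text \<open>In its own layer the arch of the step itself serves. For a lower layer, the path climbs
  through it one last time before \<open>i\<close>, and the arch opened there is still open at
  \<open>i\<close>.\<close>

lemma arch_above_step:
  assumes "i < 2 * k" "0 \<le> y" "y \<le> layer w i"
  obtains j where "j \<in> {1..k}" "lo j \<le> i" "i \<le> hi j" "layer w (hi j) = y"
proof (cases "y = layer w i")
  case True
  note a = arch[OF label_in_range[OF assms(1)]]
  show ?thesis
    using that[of "step_label w i"] True a step_of_label[OF assms(1)] label_in_range[OF assms(1)]
    by (metis less_imp_le order_refl)
next
  case False
  let ?S = "{n. n \<le> i \<and> height w n \<le> y}"
  \<comment> \<open>The last position up to \<open>i\<close> at which the path is not above
    \<open>y\<close>; position 0 shows that there is one.\<close>
  define p where "p = Max ?S"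
  have "finite ?S" "0 \<in> ?S"
    using assms by auto
  then have "p \<in> ?S"
    unfolding p_def by (intro Max_in) auto
  have max: "n \<le> p" if "n \<in> ?S" for n
    unfolding p_def using that \<open>finite ?S\<close> by simp
  have "y < layer w i"
    using False assms(3) by simp
  then have "y < height w i"
    by (simp add: layer_def)
  with \<open>p \<in> ?S\<close> have p: "p < i" "height w p \<le> y"
    by (auto simp: le_less)
  have "Suc p \<notin> ?S"
    using max[of "Suc p"] by fastforce
  with p have "height w (Suc p) > y"
    by auto
  with p assms have "w ! p = 0" "height w p = y"
    using height_Suc[of p] by (auto split: if_splits)
  then have lay: "layer w p = y"
    using p assms layer_up by simp
  let ?j = "step_label w p"
  have p2: "p < 2 * k" using p assms by simp
  have j: "?j \<in> {1..k}" using label_in_range[OF p2] .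
  note a = arch[OF j]
  have lo: "lo ?j = p"
    using step_of_label[OF p2] \<open>w ! p = 0\<close> a by auto
  \<comment> \<open>If the arch closed before \<open>i\<close>, the path would be back at height
    \<open>y\<close> after \<open>p\<close>.\<close>
  have "i \<le> hi ?j"
  proof (rule ccontr)
    assume "\<not> i \<le> hi ?j"
    moreover have "height w (Suc (hi ?j)) = y"
      using layer_down[of "hi ?j"] a lo lay by simp
    ultimately show False
      using max[of "Suc (hi ?j)"] a(6) lo by auto
  qed
  then show ?thesis
    using that[of ?j] j lo p a lay by auto
qed

section \<open>Labelled arches above a step, and how they single out the next down-step\<close>

definition arches_above :: "nat \<Rightarrow> nat \<Rightarrow> nat set" where
  "arches_above j i = {q \<in> {1..<j}. lo q \<le> i \<and> i \<le> hi q}"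

text \<open>The arches in question are nested over \<open>hi j\<close>, so their layers are
  distinct, nonnegative and below that of \<open>hi j\<close>.\<close>

lemma card_arches_above_hi:
  assumes "j \<in> {1..k}"
  shows "int (card (arches_above j (hi j))) \<le> layer w (hi j)"
proof -
  let ?E = "arches_above j (hi j)"
  \<comment> \<open>The inequalities are strict because the ends of these arches carry labels other
    than \<open>j\<close>.\<close>
  have E: "q \<in> {1..k}" "lo q < hi j" "hi j < hi q" if "q \<in> ?E" for q
  proof -
    show q: "q \<in> {1..k}"
      using that assms by (auto simp: arches_above_def)
    show "lo q < hi j" "hi j < hi q"
      using that arch(4,5)[OF q] arch(5)[OF assms] by (auto simp: arches_above_def le_less)
  qed
  have "inj_on (\<lambda>q. layer w (hi q)) ?E"
  proof (rule inj_onI)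
    fix q s
    assume q: "q \<in> ?E" and s: "s \<in> ?E" and eq: "layer w (hi q) = layer w (hi s)"
    \<comment> \<open>Both arches pass over \<open>hi j\<close>, so the one starting further right
      starts inside the other and would have a higher layer.\<close>
    have "\<not> lo q < lo s" "\<not> lo s < lo q"
      using layer_inside_arch[of q "lo s"] layer_inside_arch[of s "lo q"] E[OF q] E[OF s] eq
        arch(7)[of q] arch(7)[of s] by auto
    then have "lo q = lo s"
      by simp
    then show "q = s"
      using arch(4)[OF E(1)[OF q]] arch(4)[OF E(1)[OF s]] by metis
  qed
  moreover have "(\<lambda>q. layer w (hi q)) ` ?E \<subseteq> {0..<layer w (hi j)}"
    using E layer_inside_arch layer_nonneg arch(1) by fastforce
  ultimately have "card ?E \<le> card {0..<layer w (hi j)}"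
    by (rule card_inj_on_le) simp
  then show ?thesis
    using layer_nonneg[OF arch(1)[OF assms]] by simp
qed

text \<open>Each layer below that of \<open>hi j\<close> contains an arch above \<open>i\<close>,
  and its label is below \<open>j\<close>. If \<open>i\<close> is to the right of
  \<open>hi j\<close>, the arch above \<open>i\<close> in the layer of \<open>hi j\<close> ends to
  the right of \<open>hi j\<close> and so has a smaller label too. With
  \<open>card_arches_above_hi\<close>, this makes \<open>hi j\<close> the rightmost minimum of the
  count among the steps with label at least \<open>j\<close>.\<close>

lemma card_arches_above_unlabelled:
  assumes "j \<in> {1..k}" "i < 2 * k" "j \<le> step_label w i"
  shows "layer w (hi j) + (if hi j < i then 1 else 0) \<le> int (card (arches_above j i))"
proof -
  \<comment> \<open>Each of the layers 0, ..., \<open>?m - 1\<close> will supply one arch of label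
    below \<open>j\<close> above \<open>i\<close>.\<close>
  let ?m = "layer w (hi j) + (if hi j < i then 1 else 0)"
  let ?f = "\<lambda>q. layer w (hi q)"
  have lay: "layer w (hi j) \<le> layer w i"
    using step_label_less_if_layer_less[OF assms(2) arch(1)[OF assms(1)]] arch(5)[OF assms(1)] assms(3)
    by linarith
  have "y \<in> ?f ` arches_above j i" if "0 \<le> y" "y < ?m" for y
  proof -
    have "y \<le> layer w i"
      using that lay by (auto split: if_splits)
    with that obtain q where q: "q \<in> {1..k}" "lo q \<le> i" "i \<le> hi q" "?f q = y"
      using arch_above_step[OF assms(2)] by metis
    have "y < layer w (hi j) \<or> y = layer w (hi j) \<and> hi j < hi q"
      using that q by (auto split: if_splits)
    then have "step_label w (hi q) < step_label w (hi j)"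
      using step_label_less_if_layer_less[of "hi q" "hi j"] step_label_less_if_right[of "hi j" "hi q"]
        q arch[OF q(1)] arch[OF assms(1)] by auto
    then have "q < j"
      using arch(5)[OF q(1)] arch(5)[OF assms(1)] by simp
    then show ?thesis
      using q by (auto simp: arches_above_def)
  qed
  then have "{0..<?m} \<subseteq> ?f ` arches_above j i"
    by auto
  then have "card {0..<?m} \<le> card (arches_above j i)"
    by (rule surj_card_le[rotated]) (simp add: arches_above_def)
  then show ?thesis
    by simp
qed

section \<open>Reconstruction of the word from its clone\<close>

lemma downs_eq: "{i. i < 2 * k \<and> w ! i = 1} = hi ` {1..k}"
proof (intro equalityI subsetI)
  fix i assume "i \<in> {i. i < 2 * k \<and> w ! i = 1}"
  then have i: "i < 2 * k" "w ! i = 1" by auto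
  then have "i = hi (step_label w i)"
    using step_of_label[of i] arch(2)[OF label_in_range[of i]] by auto
  then show "i \<in> hi ` {1..k}"
    using label_in_range[OF i(1)] by blast
qed (use arch in auto)

end

text \<open>Only labels below \<open>j\<close> enter \<open>arches_above\<close>, so both paths have
  the same counts. The position chosen by \<open>w\<close> is also a candidate for \<open>v\<close>,
  and \<open>v\<close> takes the rightmost minimum.\<close>

lemma card_arches_above_hi_le_if_agree:
  assumes "dyck_path k v" "dyck_path k w" "j \<in> {1..k}"
    and agree: "\<And>q. q \<in> {1..<j} \<Longrightarrow>
      dyck_path.lo v q = dyck_path.lo w q \<and> dyck_path.hi v q = dyck_path.hi w q"
  shows "int (card (dyck_path.arches_above v j (dyck_path.hi v j))) +
    (if dyck_path.hi v j < dyck_path.hi w j then 1 else 0)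
    \<le> int (card (dyck_path.arches_above w j (dyck_path.hi w j)))"
proof -
  interpret v: dyck_path k v by fact
  interpret w: dyck_path k w by fact
  have eq: "v.arches_above j i = w.arches_above j i" for i
    using agree by (auto simp: v.arches_above_def w.arches_above_def)
  have r: "w.hi j < 2 * k"
    using w.arch(1)[OF assms(3)] .
  \<comment> \<open>A smaller label in \<open>v\<close> would make this position an end of an arch
    shared with \<open>w\<close>, where it carries the label \<open>j\<close>.\<close>
  have "j \<le> step_label v (w.hi j)"
  proof (rule ccontr)
    let ?q = "step_label v (w.hi j)"
    assume "\<not> j \<le> ?q"
    then have q: "?q \<in> {1..<j}" "?q \<in> {1..k}"
      using v.label_in_range[OF r] by auto
    then have "w.hi j = w.lo ?q \<or> w.hi j = w.hi ?q"
      using v.step_of_label[OF r] agree by auto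
    then show False
      using w.arch(4,5)[OF q(2)] w.arch(5)[OF assms(3)] q by auto
  qed
  then show ?thesis
    using v.card_arches_above_hi[OF assms(3)] v.card_arches_above_unlabelled[OF assms(3) r]
    by (simp add: eq)
qed

lemma dyck_word_eq_if_clone_eq:
  assumes "dyck_word k v" "dyck_word k w" "clone k (dyck_nest v) = clone k (dyck_nest w)"
  shows "v = w"
proof -
  interpret v: dyck_path k v by unfold_locales fact
  interpret w: dyck_path k w by unfold_locales fact
  have entry: "clone_entry (dyck_nest v) j = clone_entry (dyck_nest w) j" if "j \<in> {1..<k}" for j
    using assms(3) that by (auto simp: clone_def)
  \<comment> \<open>Adding the two inequalities obtained by exchanging \<open>v\<close> and
    \<open>w\<close> leaves no room for the extra 1 on either side.\<close>
  have hi_step: "v.hi j = w.hi j" if "j \<in> {1..k}"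
    "\<And>q. q \<in> {1..<j} \<Longrightarrow> v.lo q = w.lo q \<and> v.hi q = w.hi q" for j
    using card_arches_above_hi_le_if_agree[OF v.dyck_path_axioms w.dyck_path_axioms that]
      card_arches_above_hi_le_if_agree[OF w.dyck_path_axioms v.dyck_path_axioms that(1)] that(2)
    by (fastforce split: if_splits)
  \<comment> \<open>The range stops before \<open>k\<close> because the clone has entries for the
    labels 1, ..., \<open>k - 1\<close> only.\<close>
  have lo_hi: "v.lo j = w.lo j \<and> v.hi j = w.hi j" if "j \<in> {1..<k}" for j
    using that
  proof (induction j rule: less_induct)
    case (less j)
    then have "v.hi j = w.hi j"
      by (intro hi_step) auto
    then show ?case
      using v.lo_eq_hi_minus_clone_entry[of j] w.lo_eq_hi_minus_clone_entry[of j] entry[of j] less.prems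
      by simp
  qed
  \<comment> \<open>The down-step labelled \<open>k\<close> is determined by the arches of smaller
    labels, without its own arch length. The positions of all down-steps then fix the word.\<close>
  have "v.hi j = w.hi j" if "j \<in> {1..k}" for j
    using that by (intro hi_step lo_hi) auto
  then have "v.hi ` {1..k} = w.hi ` {1..k}"
    by (rule image_cong[OF refl])
  then have downs: "{i. i < 2 * k \<and> v ! i = 1} = {i. i < 2 * k \<and> w ! i = 1}"
    by (simp only: v.downs_eq w.downs_eq)
  show ?thesis
  proof (rule nth_equalityI)
    show "length v = length w"
      by (simp add: v.length_w w.length_w)
    fix i assume "i < length v"
    then have i: "i < 2 * k"
      by (simp add: v.length_w)
    have "v ! i = 1 \<longleftrightarrow> w ! i = 1"
      using downs i by blast
    then show "v ! i = w ! i"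
      using v.step_cases[OF i] w.step_cases[OF i] by auto
  qed
qed

theorem theorem40:
  fixes k :: nat
  assumes "k \<ge> 1"
  shows "bij_betw (clone k) (dyck_nests k) (clone k ` dyck_nests k)"
  by (rule inj_on_imp_bij_betw, rule inj_onI)
    (auto simp: dyck_nests_def dest: dyck_word_eq_if_clone_eq)

end
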